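(* Let $k\ge1$ be an integer, let $E\subset\mathbb{R}^2$ be a polygon, let $S$ be an integer with $\frac{(k+1)(k+2)}{2}\le S\le N_E$, and suppose the degrees of freedom of $V_{k,k}(E)$ are ordered as $\delta_1,\dots,\delta_{N_E}$ in such a way that $\delta_1,\dots,\delta_S$ contain all the boundary degrees of freedom and satisfy property $\mathscr{S}$: every $p\in\mathbb{P}_k(E)$ with $\delta_1(p)=\dots=\delta_S(p)=0$ is identically zero. Let $\mathcal{D}:V_{k,k}(E)\to\mathbb{R}^S$, $\mathcal{D}\varphi=(\delta_1(\varphi),\dots,\delta_S(\varphi))$, and let $(\cdot,\cdot)_{\mathbb{R}^S}$ be the Euclidean scalar product (or any symmetric positive definite bilinear form) on $\mathbb{R}^S$. Then for every $\varphi\in V_{k,k}(E)$ there is a unique $\Pi^{\mathcal S}_k\varphi\in\mathbb{P}_k(E)$ such that $$(\mathcal{D}(\Pi^{\mathcal S}_k\varphi-\varphi),\mathcal{D}q)_{\mathbb{R}^S}=0\qquad\forall q\in\mathbb{P}_k(E),$$ and the resulting operator $\Pi^{\mathcal S}_k:V_{k,k}(E)\to\mathbb{P}_k(E)$ is such that $\Pi^{\mathcal S}_k\varphi$ is computable using only $\delta_1(\varphi),\dots,\delta_S(\varphi)$, and $\Pi^{\mathcal S}_kq_k=q_k$ for all $q_k\in\mathbb{P}_k(E)$.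
   Context: $\mathbb{P}_k(\mathcal{O})$ denotes the polynomials of degree $\le k$ restricted to $\mathcal{O}$ (in two variables on $E$, in one variable on an edge $e$), with $\mathbb{P}_{-1}=\{0\}$. $E$ is a polygon with diameter $h_E$ satisfying the standing assumption that, for some $\rho_0>0$, $E$ is star-shaped with respect to all the points of a ball of radius $\rho_0 h_E$ and every edge $e$ of $E$ has length $|e|\ge\rho_0 h_E$. The space is $V_{k,k}(E)=\{\varphi\in C^0(\overline{E}):\ \varphi_{|e}\in\mathbb{P}_k(e)\ \text{for every edge } e,\ \Delta\varphi\in\mathbb{P}_k(E)\}$. Its degrees of freedom are: (1) the values of $\varphi$ at the vertices; (2) the edge moments $\int_e\varphi\,q\,ds$ for $q$ in a basis of $\mathbb{P}_{k-2}(e)$, for every edge $e$; (3) the internal moments $\int_E\varphi\,q\,dE$ for $q$ in a basis of $\mathbb{P}_k(E)$. Those in (1) and (2) are called the boundary degrees of freedom. If $E$ has $N_e$ edges, the total number of degrees of freedom is $N_E=kN_e+\frac{(k+1)(k+2)}{2}=\dim V_{k,k}(E)$, and they are unisolvent for $V_{k,k}(E)$. "Computable using only $\delta_1(\varphi),\dots,\delta_S(\varphi)$" means that the operator factors through $\mathcal{D}$: there is a linear map $L:\mathbb{R}^S\to\mathbb{P}_k(E)$ with $\Pi^{\mathcal S}_k\varphi=L(\delta_1(\varphi),\dots,\delta_S(\varphi))$ for all $\varphi\in V_{k,k}(E)$. *)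

theory Defs
  imports
    "HOL-Analysis.Analysis"
    "HOL-Computational_Algebra.Polynomial"
    "HOL-Library.Function_Algebras"
begin

text \<open>
  Conventions. A function on a set \<open>X\<close> is represented by its extension by zero to the whole
  type, so that the functions on \<open>X\<close> form a genuine subspace of the function type and
  "identically zero" and "unique" are literal equalities of functions.
  Elements of \<open>V\<^sub>k\<^sub>,\<^sub>k(E)\<close> and of \<open>P\<^sub>k(E)\<close> are functions on \<open>closure E\<close>.
\<close>

instantiation "fun" :: (type, real_vector) real_vector
begin

definition scaleR_fun :: "real \<Rightarrow> ('a \<Rightarrow> 'b) \<Rightarrow> 'a \<Rightarrow> 'b"
  where "scaleR_fun c f = (\<lambda>x. c *\<^sub>R f x)"

instance
  by standard (simp_all add: scaleR_fun_def fun_eq_iff scaleR_add_left scaleR_add_right)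

end

lemma scaleR_fun_apply [simp]: "(c *\<^sub>R f) x = c *\<^sub>R f x"
  by (simp add: scaleR_fun_def)

definition is_basis :: "'a::real_vector set \<Rightarrow> 'a set \<Rightarrow> bool"
  where "is_basis Q W \<longleftrightarrow> independent Q \<and> span Q = W"

type_synonym plane = "real^2"


subsection \<open>Polygons\<close>

definition edge_start :: "plane list \<Rightarrow> nat \<Rightarrow> plane"
  where "edge_start vs i = vs ! i"

definition edge_end :: "plane list \<Rightarrow> nat \<Rightarrow> plane"
  where "edge_end vs i = vs ! (Suc i mod length vs)"

definition edge :: "plane list \<Rightarrow> nat \<Rightarrow> plane set"
  where "edge vs i = closed_segment (edge_start vs i) (edge_end vs i)"

text \<open>
  The list \<open>vs\<close> enumerates the vertices of a simple closed polygonal line: two distinct edges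
  meet only in common endpoints. Straight angles at a vertex are allowed.
\<close>

definition simple_polygonal_line :: "plane list \<Rightarrow> bool"
  where "simple_polygonal_line vs \<longleftrightarrow>
    length vs \<ge> 3 \<and> distinct vs \<and>
    (\<forall>i<length vs. \<forall>j<length vs. i \<noteq> j \<longrightarrow>
      edge vs i \<inter> edge vs j =
        {edge_start vs i, edge_end vs i} \<inter> {edge_start vs j, edge_end vs j})"

text \<open>The polygon is the open region; its number of edges is \<open>length vs\<close>.\<close>

definition polygon :: "plane list \<Rightarrow> plane set \<Rightarrow> bool"
  where "polygon vs E \<longleftrightarrow>
    simple_polygonal_line vs \<and> open E \<and> connected E \<and> bounded E \<and>
    frontier E = (\<Union>i<length vs. edge vs i)"

definition shape_regular :: "real \<Rightarrow> plane list \<Rightarrow> plane set \<Rightarrow> bool"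
  where "shape_regular \<rho> vs E \<longleftrightarrow>
    (\<exists>z. \<forall>y\<in>ball z (\<rho> * diameter E). \<forall>x\<in>E. closed_segment y x \<subseteq> E) \<and>
    (\<forall>i<length vs. dist (edge_start vs i) (edge_end vs i) \<ge> \<rho> * diameter E)"


subsection \<open>Polynomial spaces\<close>

text \<open>The degree bound is an integer so that the spaces are \<open>{0}\<close> for degree bound \<open>-1\<close>.\<close>

definition Poly_plane :: "int \<Rightarrow> plane set \<Rightarrow> (plane \<Rightarrow> real) set"
  where "Poly_plane m X =
    {p. (\<forall>x. x \<notin> X \<longrightarrow> p x = 0) \<and>
        (\<exists>c. \<forall>x\<in>X. p x =
          (\<Sum>(a, b)\<in>{(a, b). int a + int b \<le> m}. c a b * (x $ 1) ^ a * (x $ 2) ^ b))}"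

text \<open>On a segment, polynomials in one variable with respect to the affine parameter.\<close>

definition Poly_segment :: "int \<Rightarrow> plane \<Rightarrow> plane \<Rightarrow> (plane \<Rightarrow> real) set"
  where "Poly_segment m u v =
    {q. (\<forall>x. x \<notin> closed_segment u v \<longrightarrow> q x = 0) \<and>
        (\<exists>p :: real poly. (p = 0 \<or> int (degree p) \<le> m) \<and>
          (\<forall>t\<in>{0..1}. q (linepath u v t) = poly p t))}"

definition restrict_zero :: "('a \<Rightarrow> real) \<Rightarrow> 'a set \<Rightarrow> 'a \<Rightarrow> real"
  where "restrict_zero f X = (\<lambda>x. if x \<in> X then f x else 0)"


subsection \<open>The distributional Laplacian\<close>

definition partial_deriv :: "2 \<Rightarrow> (plane \<Rightarrow> real) \<Rightarrow> plane \<Rightarrow> real"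
  where "partial_deriv i f = (\<lambda>x. frechet_derivative f (at x) (axis i 1))"

definition laplacian :: "(plane \<Rightarrow> real) \<Rightarrow> plane \<Rightarrow> real"
  where "laplacian f = (\<lambda>x. \<Sum>i\<in>UNIV. partial_deriv i (partial_deriv i f) x)"

text \<open>
  Smoothness: all iterated partial derivatives exist and are (totally) differentiable,
  hence continuous.
\<close>

definition test_function :: "plane set \<Rightarrow> (plane \<Rightarrow> real) \<Rightarrow> bool"
  where "test_function U \<eta> \<longleftrightarrow>
    (\<forall>is x. foldr partial_deriv is \<eta> differentiable (at x)) \<and>
    compact (closure {x. \<eta> x \<noteq> 0}) \<and> closure {x. \<eta> x \<noteq> 0} \<subseteq> U"

definition has_laplacian_on :: "(plane \<Rightarrow> real) \<Rightarrow> (plane \<Rightarrow> real) \<Rightarrow> plane set \<Rightarrow> bool"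
  where "has_laplacian_on \<phi> f U \<longleftrightarrow>
    (\<forall>\<eta>. test_function U \<eta> \<longrightarrow>
      (LINT x:U|lborel. \<phi> x * laplacian \<eta> x) = (LINT x:U|lborel. f x * \<eta> x))"


subsection \<open>The virtual element space and its degrees of freedom\<close>

definition VEM :: "nat \<Rightarrow> plane list \<Rightarrow> plane set \<Rightarrow> (plane \<Rightarrow> real) set"
  where "VEM k vs E =
    {\<phi>. (\<forall>x. x \<notin> closure E \<longrightarrow> \<phi> x = 0) \<and>
        continuous_on (closure E) \<phi> \<and>
        (\<forall>i<length vs. restrict_zero \<phi> (edge vs i) \<in>
           Poly_segment (int k) (edge_start vs i) (edge_end vs i)) \<and>
        (\<exists>f\<in>Poly_plane (int k) (closure E). has_laplacian_on \<phi> f E)}"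

datatype dof =
    Vertex_Value nat
  | Edge_Moment nat "plane \<Rightarrow> real"
  | Internal_Moment "plane \<Rightarrow> real"

definition line_integral :: "plane \<Rightarrow> plane \<Rightarrow> (plane \<Rightarrow> real) \<Rightarrow> real"
  where "line_integral u v f = dist u v * (LINT t:{0..1}|lborel. f (linepath u v t))"

fun dof_value :: "plane list \<Rightarrow> plane set \<Rightarrow> dof \<Rightarrow> (plane \<Rightarrow> real) \<Rightarrow> real" where
  "dof_value vs E (Vertex_Value i) \<phi> = \<phi> (vs ! i)"
| "dof_value vs E (Edge_Moment i q) \<phi> =
     line_integral (edge_start vs i) (edge_end vs i) (\<lambda>x. \<phi> x * q x)"
| "dof_value vs E (Internal_Moment q) \<phi> = (LINT x:E|lborel. \<phi> x * q x)"

text \<open>\<open>Qe i\<close> is the chosen basis of \<open>P\<^sub>k\<^sub>-\<^sub>2\<close> on edge \<open>i\<close>, and \<open>QE\<close> that of \<open>P\<^sub>k(E)\<close>.\<close>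

definition moment_bases ::
    "nat \<Rightarrow> plane list \<Rightarrow> plane set \<Rightarrow> (nat \<Rightarrow> (plane \<Rightarrow> real) set) \<Rightarrow> (plane \<Rightarrow> real) set \<Rightarrow> bool"
  where "moment_bases k vs E Qe QE \<longleftrightarrow>
    (\<forall>i<length vs.
       is_basis (Qe i) (Poly_segment (int k - 2) (edge_start vs i) (edge_end vs i))) \<and>
    is_basis QE (Poly_plane (int k) (closure E))"

definition boundary_dofs :: "plane list \<Rightarrow> (nat \<Rightarrow> (plane \<Rightarrow> real) set) \<Rightarrow> dof set"
  where "boundary_dofs vs Qe =
    {Vertex_Value i | i. i < length vs} \<union> {Edge_Moment i q | i q. i < length vs \<and> q \<in> Qe i}"

definition all_dofs ::
    "plane list \<Rightarrow> (nat \<Rightarrow> (plane \<Rightarrow> real) set) \<Rightarrow> (plane \<Rightarrow> real) set \<Rightarrow> dof set"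
  where "all_dofs vs Qe QE = boundary_dofs vs Qe \<union> Internal_Moment ` QE"

definition num_dofs :: "nat \<Rightarrow> plane list \<Rightarrow> nat"
  where "num_dofs k vs = k * length vs + (k + 1) * (k + 2) div 2"


subsection \<open>The serendipity projection\<close>

text \<open>\<open>R^S\<close>, with coordinates indexed by \<open>1, ..., S\<close>.\<close>

definition coord_space :: "nat \<Rightarrow> (nat \<Rightarrow> real) set"
  where "coord_space S = {u. \<forall>i. i \<notin> {1..S} \<longrightarrow> u i = 0}"

definition dof_vector ::
    "nat \<Rightarrow> (nat \<Rightarrow> (plane \<Rightarrow> real) \<Rightarrow> real) \<Rightarrow> (plane \<Rightarrow> real) \<Rightarrow> nat \<Rightarrow> real"
  where "dof_vector S \<delta> \<phi> = (\<lambda>i. if i \<in> {1..S} then \<delta> i \<phi> else 0)"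

definition property_S ::
    "nat \<Rightarrow> plane set \<Rightarrow> nat \<Rightarrow> (nat \<Rightarrow> (plane \<Rightarrow> real) \<Rightarrow> real) \<Rightarrow> bool"
  where "property_S k E S \<delta> \<longleftrightarrow>
    (\<forall>p\<in>Poly_plane (int k) (closure E). (\<forall>i\<in>{1..S}. \<delta> i p = 0) \<longrightarrow> p = 0)"

definition scalar_product_on :: "'a::real_vector set \<Rightarrow> ('a \<Rightarrow> 'a \<Rightarrow> real) \<Rightarrow> bool"
  where "scalar_product_on W B \<longleftrightarrow>
    (\<forall>u\<in>W. \<forall>v\<in>W. \<forall>w\<in>W. \<forall>a b. B (a *\<^sub>R u + b *\<^sub>R v) w = a * B u w + b * B v w) \<and>
    (\<forall>u\<in>W. \<forall>v\<in>W. B u v = B v u) \<and>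
    (\<forall>u\<in>W. u \<noteq> 0 \<longrightarrow> B u u > 0)"

lemma scalar_product_on_euclidean:
  "scalar_product_on (coord_space S) (\<lambda>u v. \<Sum>i=1..S. u i * v i)"
proof -
  have "(\<Sum>i=1..S. u i * u i) > 0" if "u \<in> coord_space S" "u \<noteq> 0" for u
  proof -
    from that obtain j where j: "u j \<noteq> 0" by (auto simp: fun_eq_iff)
    with that(1) have "j \<in> {1..S}" by (auto simp: coord_space_def)
    moreover have "u j * u j > 0" using j not_real_square_gt_zero by blast
    ultimately show ?thesis
      by (intro sum_pos2[where i = j]) auto
  qed
  then show ?thesis
    unfolding scalar_product_on_def
    by (auto simp: mult.commute sum_distrib_left sum.distrib[symmetric] algebra_simps)
qed

definition linear_map_on ::
    "'a::real_vector set \<Rightarrow> 'b::real_vector set \<Rightarrow> ('a \<Rightarrow> 'b) \<Rightarrow> bool"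
  where "linear_map_on U W L \<longleftrightarrow>
    (\<forall>u\<in>U. L u \<in> W) \<and>
    (\<forall>u\<in>U. \<forall>v\<in>U. L (u + v) = L u + L v) \<and>
    (\<forall>c. \<forall>u\<in>U. L (c *\<^sub>R u) = c *\<^sub>R L u)"

definition is_serendipity_projection ::
    "nat \<Rightarrow> plane set \<Rightarrow> nat \<Rightarrow> (nat \<Rightarrow> (plane \<Rightarrow> real) \<Rightarrow> real) \<Rightarrow>
     ((nat \<Rightarrow> real) \<Rightarrow> (nat \<Rightarrow> real) \<Rightarrow> real) \<Rightarrow> (plane \<Rightarrow> real) \<Rightarrow> (plane \<Rightarrow> real) \<Rightarrow> bool"
  where "is_serendipity_projection k E S \<delta> B \<phi> p \<longleftrightarrow>
    p \<in> Poly_plane (int k) (closure E) \<and>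
    (\<forall>q\<in>Poly_plane (int k) (closure E).
       B (dof_vector S \<delta> (p - \<phi>)) (dof_vector S \<delta> q) = 0)"

definition serendipity_projection ::
    "nat \<Rightarrow> plane set \<Rightarrow> nat \<Rightarrow> (nat \<Rightarrow> (plane \<Rightarrow> real) \<Rightarrow> real) \<Rightarrow>
     ((nat \<Rightarrow> real) \<Rightarrow> (nat \<Rightarrow> real) \<Rightarrow> real) \<Rightarrow> (plane \<Rightarrow> real) \<Rightarrow> plane \<Rightarrow> real"
  where "serendipity_projection k E S \<delta> B \<phi> = (THE p. is_serendipity_projection k E S \<delta> B \<phi> p)"

end

theory Submission
  imports Defs
begin

text \<open>
  The defining condition of the projection consists of the normal equations of the least-squares
  problem of fitting the data \<open>D \<phi>\<close> by vectors \<open>D p\<close> with \<open>p\<close> a polynomial: it says that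
  \<open>D p\<close> is the \<open>B\<close>-orthogonal projection of \<open>D \<phi>\<close> onto the image of the polynomials under \<open>D\<close>.
  That image is finite dimensional, so the orthogonal projection exists
  (\<open>normal_equations_solvable\<close>, by Gram-Schmidt), and property \<open>S\<close> says precisely that \<open>D\<close> is
  injective on polynomials, so the polynomial is determined by its image
  (\<open>normal_equations_unique\<close>).

  The normal equations see \<open>\<phi>\<close> only through the vector \<open>u = D \<phi>\<close> and make sense for every \<open>u\<close> in
  \<open>R\<^sup>S\<close>. Their solution operator is therefore defined on all of \<open>R\<^sup>S\<close>; it is linear because sums and
  multiples of solutions are solutions, and it is the required \<open>L\<close>. A polynomial solves its own
  normal equations, so uniqueness makes the projection the identity on polynomials.

  The analytic content is that the degrees of freedom are linear
  (\<open>dof_value_linear\<close>), which comes down to the integrability of the moments. They are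
  integrable because \<open>\<phi>\<close> is continuous on the compact set \<open>closure E\<close>, so \<open>D\<close> is treated as a
  linear map on all functions continuous there, a space which contains both \<open>V\<^sub>k\<^sub>,\<^sub>k(E)\<close> and the
  polynomials.
\<close>

section \<open>Normal equations for a scalar product on a subspace\<close>

lemma scalar_product_on_bilinear:
  assumes B: "scalar_product_on W B" and W: "subspace W"
  shows scalar_product_on_add_left: "\<lbrakk>u \<in> W; v \<in> W; w \<in> W\<rbrakk> \<Longrightarrow> B (u + v) w = B u w + B v w"
    and scalar_product_on_scale_left: "\<lbrakk>u \<in> W; w \<in> W\<rbrakk> \<Longrightarrow> B (a *\<^sub>R u) w = a * B u w"
    and scalar_product_on_diff_left: "\<lbrakk>u \<in> W; v \<in> W; w \<in> W\<rbrakk> \<Longrightarrow> B (u - v) w = B u w - B v w"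
    and scalar_product_on_add_right: "\<lbrakk>u \<in> W; v \<in> W; w \<in> W\<rbrakk> \<Longrightarrow> B w (u + v) = B w u + B w v"
    and scalar_product_on_scale_right: "\<lbrakk>u \<in> W; w \<in> W\<rbrakk> \<Longrightarrow> B w (a *\<^sub>R u) = a * B w u"
proof -
  have lin: "B (a *\<^sub>R u + b *\<^sub>R v) w = a * B u w + b * B v w"
    if "u \<in> W" "v \<in> W" "w \<in> W" for a b u v w
    using B that by (simp add: scalar_product_on_def)
  have sym: "B u v = B v u" if "u \<in> W" "v \<in> W" for u v
    using B that by (simp add: scalar_product_on_def)
  show add: "B (u + v) w = B u w + B v w" if "u \<in> W" "v \<in> W" "w \<in> W" for u v w
    using lin[OF that, of 1 1] by simp
  show scale: "B (a *\<^sub>R u) w = a * B u w" if "u \<in> W" "w \<in> W" for u w a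
    using lin[OF that(1,1,2), of a 0] by simp
  show "B (u - v) w = B u w - B v w" if "u \<in> W" "v \<in> W" "w \<in> W" for u v w
    using lin[OF that, of 1 "-1"] by simp
  show "B w (u + v) = B w u + B w v" if "u \<in> W" "v \<in> W" "w \<in> W" for u v w
    using add[OF that] that by (simp add: sym subspace_add[OF W])
  show "B w (a *\<^sub>R u) = a * B w u" if "u \<in> W" "w \<in> W" for u w a
    using scale[OF that] that by (simp add: sym subspace_scale[OF W])
qed

lemma linear_map_on_diff:
  assumes "linear_map_on U W D" "subspace U" "u \<in> U" "v \<in> U"
  shows "D (u - v) = D u - D v"
proof -
  have "D (u + (-1) *\<^sub>R v) = D u + D ((-1) *\<^sub>R v)"
    using assms subspace_scale[OF assms(2,4)] unfolding linear_map_on_def by blast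
  also have "D ((-1) *\<^sub>R v) = (-1) *\<^sub>R D v"
    using assms unfolding linear_map_on_def by blast
  finally show ?thesis by simp
qed

text \<open>
  Gram-Schmidt, carried out in the domain of \<open>D\<close>: a new generator \<open>a\<close> is replaced by \<open>b = a - r\<close>
  with \<open>D b\<close> orthogonal to the image of the old span, and the old solution is corrected by a
  multiple of \<open>b\<close>. If \<open>D b = 0\<close>, the image does not grow and the old solution still works.
\<close>

lemma normal_equations_solvable:
  assumes B: "scalar_product_on W B" and W: "subspace W"
    and D: "linear_map_on U W D" and U: "subspace U"
    and "finite M" "M \<subseteq> U" "u \<in> W"
  shows "\<exists>p\<in>span M. \<forall>q\<in>span M. B (D p - u) (D q) = 0"
  using assms(5-7)
proof (induction M arbitrary: u rule: finite_induct)
  case empty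
  have "D 0 = 0"
    using linear_map_on_diff[OF D U subspace_0[OF U] subspace_0[OF U]] by simp
  moreover have "B (- u) 0 = 0"
    using scalar_product_on_scale_right[OF B W subspace_0[OF W] subspace_neg[OF W empty(2)], of 0]
    by simp
  ultimately show ?case by simp
next
  case (insert a M)
  note [simp] = scalar_product_on_add_left[OF B W] scalar_product_on_scale_left[OF B W]
    scalar_product_on_add_right[OF B W] scalar_product_on_scale_right[OF B W]
  have DW [simp]: "D x \<in> W" if "x \<in> U" for x
    using D that by (simp add: linear_map_on_def)
  have D_add: "D (x + y) = D x + D y" if "x \<in> U" "y \<in> U" for x y
    using D that by (simp add: linear_map_on_def)
  have D_scale: "D (c *\<^sub>R x) = c *\<^sub>R D x" if "x \<in> U" for x c
    using D that by (simp add: linear_map_on_def)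
  have aU: "a \<in> U" and MU: "M \<subseteq> U" using insert.prems by auto
  have spanU: "x \<in> U" if "x \<in> span M" for x
    using that span_minimal[OF MU U] by blast
  obtain r where r: "r \<in> span M" "\<And>q. q \<in> span M \<Longrightarrow> B (D r - D a) (D q) = 0"
    using insert.IH[OF MU DW[OF aU]] by blast
  obtain p where p: "p \<in> span M" "\<And>q. q \<in> span M \<Longrightarrow> B (D p - u) (D q) = 0"
    using insert.IH[OF MU insert.prems(2)] by blast
  define b where "b = a - r"
  have bU: "b \<in> U" using aU spanU[OF r(1)] U by (simp add: b_def subspace_diff)
  have b_orth: "B (D b) (D q) = 0" if "q \<in> span M" for q
  proof -
    have "D b = D a - D r"
      using linear_map_on_diff[OF D U aU spanU[OF r(1)]] by (simp add: b_def)
    then show ?thesis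
      using r(2)[OF that] spanU[OF r(1)] aU spanU[OF that]
      by (simp add: scalar_product_on_diff_left[OF B W])
  qed
  have split: "\<exists>s q'. q = s *\<^sub>R b + q' \<and> q' \<in> span M" if q: "q \<in> span (insert a M)" for q
  proof -
    from q obtain s where s: "q - s *\<^sub>R a \<in> span M"
      by (auto simp: span_insert)
    have "q = s *\<^sub>R b + ((q - s *\<^sub>R a) + s *\<^sub>R r)"
      by (simp add: b_def scaleR_diff_right)
    then show ?thesis using s r(1) by (blast intro: span_add span_scale)
  qed
  have sub: "span M \<subseteq> span (insert a M)" by (intro span_mono) auto
  have b_in: "b \<in> span (insert a M)"
    unfolding b_def using r(1) sub by (intro span_diff) (auto intro: span_base)
  have res: "D p - u \<in> W" using spanU[OF p(1)] insert.prems(2) W by (simp add: subspace_diff)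
  show ?case
  proof (cases "D b = 0")
    case True
    have "B (D p - u) (D q) = 0" if "q \<in> span (insert a M)" for q
    proof -
      from split[OF that] obtain s q' where q: "q = s *\<^sub>R b + q'" "q' \<in> span M" by blast
      have "D q = D q'"
        using True bU spanU[OF q(2)] U by (simp add: q(1) D_add D_scale subspace_scale)
      then show ?thesis using p(2)[OF q(2)] by simp
    qed
    then show ?thesis using p(1) sub by blast
  next
    case False
    then have pos: "B (D b) (D b) > 0"
      using B bU by (simp add: scalar_product_on_def)
    \<comment> \<open>This \<open>c\<close> makes the corrected residual orthogonal to \<open>D b\<close>; the equations for the old span
      survive because \<open>D b\<close> is orthogonal to its image.\<close>
    define c where "c = - B (D p - u) (D b) / B (D b) (D b)"
    have "B (D (p + c *\<^sub>R b) - u) (D q) = 0" if "q \<in> span (insert a M)" for q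
    proof -
      from split[OF that] obtain s q' where q: "q = s *\<^sub>R b + q'" "q' \<in> span M" by blast
      have expand: "B (v + c *\<^sub>R x) (s *\<^sub>R x + y) = s * (B v x + c * B x x) + (B v y + c * B x y)"
        if "v \<in> W" "x \<in> W" "y \<in> W" for v x y
        using that W by (simp add: subspace_add subspace_scale algebra_simps)
      have "D (p + c *\<^sub>R b) - u = (D p - u) + c *\<^sub>R D b"
        using bU spanU[OF p(1)] U by (simp add: D_add D_scale subspace_scale)
      moreover have "D q = s *\<^sub>R D b + D q'"
        using bU spanU[OF q(2)] U by (simp add: q(1) D_add D_scale subspace_scale)
      ultimately have "B (D (p + c *\<^sub>R b) - u) (D q)
          = s * (B (D p - u) (D b) + c * B (D b) (D b))
            + (B (D p - u) (D q') + c * B (D b) (D q'))"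
        using expand[OF res DW[OF bU] DW[OF spanU[OF q(2)]]] by (simp only:)
      then show ?thesis
        using pos p(2)[OF q(2)] b_orth[OF q(2)] by (simp add: c_def)
    qed
    moreover have "p + c *\<^sub>R b \<in> span (insert a M)"
      using p(1) sub b_in by (blast intro: span_add span_scale)
    ultimately show ?thesis by blast
  qed
qed

text \<open>
  The difference of two solutions is a test function in both sets of normal equations, hence
  \<open>D\<close> of it is orthogonal to itself.
\<close>

lemma normal_equations_unique:
  assumes B: "scalar_product_on W B" and W: "subspace W"
    and D: "linear_map_on P W D" and P: "subspace P"
    and inj: "\<And>p. p \<in> P \<Longrightarrow> D p = 0 \<Longrightarrow> p = 0"
    and u: "u \<in> W"
    and p: "p \<in> P" "\<forall>q\<in>P. B (D p - u) (D q) = 0"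
    and p': "p' \<in> P" "\<forall>q\<in>P. B (D p' - u) (D q) = 0"
  shows "p = p'"
proof -
  have diff: "p - p' \<in> P" using p(1) p'(1) P by (simp add: subspace_diff)
  have DW: "D x \<in> W" if "x \<in> P" for x using D that by (simp add: linear_map_on_def)
  have res: "D p - u \<in> W" "D p' - u \<in> W"
    using DW p(1) p'(1) u W by (simp_all add: subspace_diff)
  have "D (p - p') = (D p - u) - (D p' - u)"
    using linear_map_on_diff[OF D P p(1) p'(1)] by simp
  then have "B (D (p - p')) (D (p - p')) = B (D p - u) (D (p - p')) - B (D p' - u) (D (p - p'))"
    using scalar_product_on_diff_left[OF B W res DW[OF diff]] by metis
  then have "B (D (p - p')) (D (p - p')) = 0"
    using p(2) p'(2) diff by simp
  then have "D (p - p') = 0"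
    using B DW[OF diff] unfolding scalar_product_on_def by (metis less_irrefl)
  then show ?thesis using inj[OF diff] by simp
qed

lemma normal_equations_solution_operator:
  assumes B: "scalar_product_on W B" and W: "subspace W"
    and D: "linear_map_on P W D" and P: "P = span M" "finite M"
    and inj: "\<And>p. p \<in> P \<Longrightarrow> D p = 0 \<Longrightarrow> p = 0"
  shows "\<exists>L. linear_map_on W P L \<and>
    (\<forall>u\<in>W. \<forall>p. (p \<in> P \<and> (\<forall>q\<in>P. B (D p - u) (D q) = 0)) \<longleftrightarrow> p = L u)"
proof -
  have subP: "subspace P" using P by simp
  have "\<exists>p. p \<in> P \<and> (\<forall>q\<in>P. B (D p - u) (D q) = 0)" if "u \<in> W" for u
    using normal_equations_solvable[OF B W D subP P(2) _ that] P(1) span_superset by blast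
  then obtain L where L: "\<And>u. u \<in> W \<Longrightarrow> L u \<in> P"
    "\<And>u q. u \<in> W \<Longrightarrow> q \<in> P \<Longrightarrow> B (D (L u) - u) (D q) = 0"
    by metis
  have char: "p = L u" if "u \<in> W" "p \<in> P" "\<forall>q\<in>P. B (D p - u) (D q) = 0" for u p
    using normal_equations_unique[OF B W D subP inj that] L that by blast
  have DW: "D x \<in> W" if "x \<in> P" for x using D that by (simp add: linear_map_on_def)
  have res: "D (L u) - u \<in> W" if "u \<in> W" for u
    using DW L(1) that W by (simp add: subspace_diff)
  have "linear_map_on W P L"
    unfolding linear_map_on_def
  proof (intro conjI ballI allI)
    fix u v assume uv: "u \<in> W" "v \<in> W"
    have sum: "D (L u + L v) - (u + v) = (D (L u) - u) + (D (L v) - v)"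
      using D L(1) uv by (simp add: linear_map_on_def)
    have "\<forall>q\<in>P. B (D (L u + L v) - (u + v)) (D q) = 0"
      unfolding sum
      using scalar_product_on_add_left[OF B W res[OF uv(1)] res[OF uv(2)]] L(2) uv DW by simp
    then show "L (u + v) = L u + L v"
      using char[of "u + v" "L u + L v"] uv L(1) subP W by (simp add: subspace_add)
  next
    fix c u assume u: "u \<in> W"
    have scale: "D (c *\<^sub>R L u) - c *\<^sub>R u = c *\<^sub>R (D (L u) - u)"
      using D L(1) u by (simp add: linear_map_on_def scaleR_diff_right)
    have "\<forall>q\<in>P. B (D (c *\<^sub>R L u) - c *\<^sub>R u) (D q) = 0"
      unfolding scale
      using scalar_product_on_scale_left[OF B W res[OF u]] L(2) u DW by simp
    then show "L (c *\<^sub>R u) = c *\<^sub>R L u"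
      using char[of "c *\<^sub>R u" "c *\<^sub>R L u"] u L(1) subP W by (simp add: subspace_scale)
  qed (use L(1) in blast)
  moreover have "\<forall>u\<in>W. \<forall>p. (p \<in> P \<and> (\<forall>q\<in>P. B (D p - u) (D q) = 0)) \<longleftrightarrow> p = L u"
    using char L by blast
  ultimately show ?thesis by blast
qed

section \<open>Linearity of the degrees of freedom\<close>

lemma subspace_coord_space: "subspace (coord_space S)"
  by (auto simp: subspace_def coord_space_def)

lemma subspace_continuous_on: "subspace {\<phi> :: 'a::topological_space \<Rightarrow> real. continuous_on X \<phi>}"
  by (auto simp: subspace_def zero_fun_def plus_fun_def scaleR_fun_def intro!: continuous_intros)

lemma Poly_plane_continuous_on:
  assumes "p \<in> Poly_plane m X"
  shows "continuous_on X p"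
proof -
  from assms obtain c where c: "\<And>x. x \<in> X \<Longrightarrow> p x =
      (\<Sum>(a, b)\<in>{(a, b). int a + int b \<le> m}. c a b * (x $ 1) ^ a * (x $ 2) ^ b)"
    by (auto simp: Poly_plane_def)
  have "continuous_on X (\<lambda>x::plane.
      \<Sum>(a, b)\<in>{(a, b). int a + int b \<le> m}. c a b * (x $ 1) ^ a * (x $ 2) ^ b)"
    by (auto intro!: continuous_intros simp: case_prod_beta)
  then show ?thesis using c by (simp cong: continuous_on_cong)
qed

lemma Poly_segment_continuous_on:
  assumes "q \<in> Poly_segment m u v"
  shows "continuous_on {0..1} (\<lambda>t. q (linepath u v t))"
proof -
  from assms obtain p where p: "\<forall>t\<in>{0..1}. q (linepath u v t) = poly p t"
    by (auto simp: Poly_segment_def simp del: atLeastAtMost_iff)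
  have "continuous_on {0..1} (poly p)"
    by (intro continuous_intros)
  then show ?thesis
    by (rule continuous_on_eq) (simp add: p)
qed

lemma edge_subset_closure:
  assumes "polygon vs E" "i < length vs"
  shows "edge vs i \<subseteq> closure E"
  using assms unfolding polygon_def frontier_def by blast

lemma set_integrable_lborel_compact:
  fixes f :: "'a::euclidean_space \<Rightarrow> real"
  assumes "compact K" "continuous_on K f" "A \<subseteq> K" "A \<in> sets borel"
  shows "set_integrable lborel A f"
proof -
  have "set_integrable lborel K f"
    unfolding set_integrable_def using assms(1,2) by (rule borel_integrable_compact)
  then show ?thesis using assms(3,4) by (auto intro: set_integrable_subset)
qed

text \<open>
  The integral is a total function with value \<open>0\<close> on non-integrable arguments,
  so additivity of the moments depends on each integrand being integrable.
\<close>

lemma dof_value_linear: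
  assumes polygon: "polygon vs E" and bases: "moment_bases k vs E Qe QE"
    and d: "d \<in> all_dofs vs Qe QE"
    and \<phi>: "continuous_on (closure E) \<phi>" and \<psi>: "continuous_on (closure E) \<psi>"
  shows "dof_value vs E d (\<phi> + \<psi>) = dof_value vs E d \<phi> + dof_value vs E d \<psi>"
    and "dof_value vs E d (c *\<^sub>R \<phi>) = c * dof_value vs E d \<phi>"
proof -
  consider (vertex) i where "d = Vertex_Value i"
    | (edge) i q where "d = Edge_Moment i q" "i < length vs" "q \<in> Qe i"
    | (internal) q where "d = Internal_Moment q" "q \<in> QE"
    using d by (auto simp: all_dofs_def boundary_dofs_def)
  then have "dof_value vs E d (\<phi> + \<psi>) = dof_value vs E d \<phi> + dof_value vs E d \<psi> \<and>
      dof_value vs E d (c *\<^sub>R \<phi>) = c * dof_value vs E d \<phi>"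
  proof cases
    case vertex
    then show ?thesis by simp
  next
    case edge
    let ?l = "linepath (edge_start vs i) (edge_end vs i)"
    have "q \<in> Poly_segment (int k - 2) (edge_start vs i) (edge_end vs i)"
      using bases edge span_base by (force simp: moment_bases_def is_basis_def)
    then have q: "continuous_on {0..1} (\<lambda>t. q (?l t))"
      by (rule Poly_segment_continuous_on)
    have l: "?l ` {0..1} \<subseteq> closure E"
      using edge_subset_closure[OF polygon edge(2)] by (simp add: edge_def linepath_image_01)
    have int: "set_integrable lborel {0..1} (\<lambda>t. f (?l t) * q (?l t))"
      if f: "continuous_on (closure E) f" for f
    proof (rule set_integrable_lborel_compact[of "{0..1}"])
      have "continuous_on {0..1} (\<lambda>t. f (?l t))"
        using continuous_on_compose2[OF f continuous_on_linepath l] .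
      then show "continuous_on {0..1} (\<lambda>t. f (?l t) * q (?l t))"
        using q by (intro continuous_intros)
    qed auto
    show ?thesis
      using set_integral_add(2)[OF int[OF \<phi>] int[OF \<psi>]]
      by (simp add: edge line_integral_def algebra_simps)
  next
    case internal
    have "q \<in> Poly_plane (int k) (closure E)"
      using bases internal span_base by (force simp: moment_bases_def is_basis_def)
    then have q: "continuous_on (closure E) q"
      by (rule Poly_plane_continuous_on)
    have E: "open E" "compact (closure E)" using polygon by (auto simp: polygon_def)
    have int: "set_integrable lborel E (\<lambda>x. f x * q x)"
      if "continuous_on (closure E) f" for f
      using E that q
      by (intro set_integrable_lborel_compact[of "closure E"] continuous_intros)
        (auto simp: closure_subset)
    show ?thesis
      using set_integral_add(2)[OF int[OF \<phi>] int[OF \<psi>]]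
      by (simp add: internal algebra_simps)
  qed
  then show "dof_value vs E d (\<phi> + \<psi>) = dof_value vs E d \<phi> + dof_value vs E d \<psi>"
    and "dof_value vs E d (c *\<^sub>R \<phi>) = c * dof_value vs E d \<phi>"
    by auto
qed

section \<open>The serendipity projection\<close>

theorem mainTheorem4:
  fixes k S :: nat and \<rho> :: real
    and vs :: "plane list" and E :: "plane set"
    and Qe :: "nat \<Rightarrow> (plane \<Rightarrow> real) set" and QE :: "(plane \<Rightarrow> real) set"
    and d :: "nat \<Rightarrow> dof"
    and \<delta> :: "nat \<Rightarrow> (plane \<Rightarrow> real) \<Rightarrow> real"
    and B :: "(nat \<Rightarrow> real) \<Rightarrow> (nat \<Rightarrow> real) \<Rightarrow> real"
  assumes k: "k \<ge> 1"
    and polygon: "polygon vs E"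
    and regular: "\<rho> > 0" "shape_regular \<rho> vs E"
    and bases: "moment_bases k vs E Qe QE"
    and S: "(k + 1) * (k + 2) div 2 \<le> S" "S \<le> num_dofs k vs"
    and ordering: "bij_betw d {1..num_dofs k vs} (all_dofs vs Qe QE)"
    and \<delta>: "\<And>i. \<delta> i = dof_value vs E (d i)"
    and boundary: "boundary_dofs vs Qe \<subseteq> d ` {1..S}"
    and prop_S: "property_S k E S \<delta>"
    and B: "scalar_product_on (coord_space S) B"
  shows "(\<forall>\<phi>\<in>VEM k vs E. \<exists>!p. is_serendipity_projection k E S \<delta> B \<phi> p) \<and>
    (\<forall>\<phi>\<in>VEM k vs E.
       is_serendipity_projection k E S \<delta> B \<phi> (serendipity_projection k E S \<delta> B \<phi>)) \<and>
    (\<exists>L. linear_map_on (coord_space S) (Poly_plane (int k) (closure E)) L \<and>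
       (\<forall>\<phi>\<in>VEM k vs E. serendipity_projection k E S \<delta> B \<phi> = L (dof_vector S \<delta> \<phi>))) \<and>
    (\<forall>q\<in>Poly_plane (int k) (closure E). serendipity_projection k E S \<delta> B q = q)"
proof -
  let ?P = "Poly_plane (int k) (closure E)" and ?W = "coord_space S" and ?D = "dof_vector S \<delta>"
  let ?C = "{\<phi> :: plane \<Rightarrow> real. continuous_on (closure E) \<phi>}"
  have span: "?P = span QE"
    using bases by (simp add: moment_bases_def is_basis_def)
  \<comment> \<open>Each element of \<open>QE\<close> gives a degree of freedom, and only finitely many of these are listed.\<close>
  have finQE: "finite QE"
  proof -
    have "finite (all_dofs vs Qe QE)"
      using bij_betw_finite[OF ordering] by simp
    then have "finite (Internal_Moment ` QE)"
      by (rule finite_subset[rotated]) (simp add: all_dofs_def)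
    then show ?thesis
      by (rule finite_imageD) (simp add: inj_on_def)
  qed
  have PC: "?P \<subseteq> ?C" using Poly_plane_continuous_on by blast
  have VC: "VEM k vs E \<subseteq> ?C" by (auto simp: VEM_def)
  have d: "d i \<in> all_dofs vs Qe QE" if "i \<in> {1..S}" for i
    using bij_betwE[OF ordering] that S(2) by auto
  have DC: "linear_map_on ?C ?W ?D"
    unfolding linear_map_on_def
    using dof_value_linear[OF polygon bases d]
    by (auto simp: dof_vector_def coord_space_def \<delta> fun_eq_iff)
  then have DP: "linear_map_on ?P ?W ?D"
    using PC unfolding linear_map_on_def by blast
  have inj: "p = 0" if "p \<in> ?P" "?D p = 0" for p
  proof -
    have "\<forall>i\<in>{1..S}. \<delta> i p = 0"
    proof
      fix i assume "i \<in> {1..S}"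
      then have "\<delta> i p = ?D p i" by (simp add: dof_vector_def)
      then show "\<delta> i p = 0" by (simp only: that(2) zero_fun_apply)
    qed
    then show ?thesis using prop_S that(1) by (simp add: property_S_def)
  qed
  obtain L where L: "linear_map_on ?W ?P L"
    "\<And>u p. u \<in> ?W \<Longrightarrow> (p \<in> ?P \<and> (\<forall>q\<in>?P. B (?D p - u) (?D q) = 0)) \<longleftrightarrow> p = L u"
    using normal_equations_solution_operator[OF B subspace_coord_space DP span finQE inj] by blast
  have char: "is_serendipity_projection k E S \<delta> B \<phi> p \<longleftrightarrow> p = L (?D \<phi>)" if "\<phi> \<in> ?C" for \<phi> p
  proof -
    have "?D (p - \<phi>) = ?D p - ?D \<phi>" if "p \<in> ?P"
      using linear_map_on_diff[OF DC subspace_continuous_on] PC \<open>\<phi> \<in> ?C\<close> that by blast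
    moreover have "?D \<phi> \<in> ?W" by (simp add: dof_vector_def coord_space_def)
    ultimately show ?thesis
      using L(2)[of "?D \<phi>" p] unfolding is_serendipity_projection_def by auto
  qed
  have proj: "serendipity_projection k E S \<delta> B \<phi> = L (?D \<phi>)" if "\<phi> \<in> ?C" for \<phi>
    using char[OF that] by (simp add: serendipity_projection_def)
  have "q = L (?D q)" if "q \<in> ?P" for q
  proof -
    have "?D q \<in> ?W" by (simp add: dof_vector_def coord_space_def)
    moreover have "B 0 (?D q') = 0" if "q' \<in> ?P" for q'
      using scalar_product_on_scale_left[OF B subspace_coord_space, of 0 "?D q'" 0]
        subspace_0[OF subspace_coord_space] DP that
      by (simp add: linear_map_on_def)
    ultimately show ?thesis using L(2)[of "?D q" q] that by simp
  qed
  then have ident: "serendipity_projection k E S \<delta> B q = q" if "q \<in> ?P" for q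
    using proj PC that by force
  show ?thesis
  proof (intro conjI ballI)
    show "\<exists>!p. is_serendipity_projection k E S \<delta> B \<phi> p" if "\<phi> \<in> VEM k vs E" for \<phi>
      using char VC that by auto
    show "is_serendipity_projection k E S \<delta> B \<phi> (serendipity_projection k E S \<delta> B \<phi>)"
      if "\<phi> \<in> VEM k vs E" for \<phi>
      using char proj VC that by auto
    show "\<exists>L. linear_map_on ?W ?P L \<and>
        (\<forall>\<phi>\<in>VEM k vs E. serendipity_projection k E S \<delta> B \<phi> = L (?D \<phi>))"
      using L(1) proj VC by blast
  qed (use ident in blast)
qed

end
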